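(* For every integer $d\ge 0$, $$\tilde{A}_d(q,x)=1+qx\,F^{!}_d(x,qx),$$ where $\tilde{A}_d(q,x)=\sum_{\alpha\in\tilde{A}_d}q^{\max\alpha}x^{|\alpha|}$ (with $\max\epsilon=0$) and $F^{!}_d(x,y)=\sum_{n\ge0}F^{!}_{d,n}(x)y^n$.
   Context: All sequences are finite words $\alpha=a_1\ldots a_n$ ($n\ge 0$) of positive integers; $|\alpha|=n$ is the length and $\epsilon$ the empty word. For an integer $d\ge 0$, an index $i\in[n]$ is a $d$-ascent of $\alpha$ if $i=1$, or $i\ge 2$ and $a_i>a_{i-1}-d$; $\mathrm{asc}_d\alpha$ is the number of $d$-ascents. $\alpha$ is a $d$-ascent sequence if $a_i\le 1+\mathrm{asc}_d(a_1\ldots a_{i-1})$ for all $i\in[n]$; $A_d$ is the set of all $d$-ascent sequences. For a word $\alpha$ and index $j$, $M(\alpha,j)$ adds $1$ to every entry $a_i$ with $i<j$ and $a_i\ge a_j$; $M(\alpha,j_1,\dots,j_k)=M(M(\alpha,j_1,\dots,j_{k-1}),j_k)$. For $\alpha\in A_d$, $\mathrm{hat}_d(\alpha)=M(\alpha,j_1,\dots,j_k)$ with $j_1<\dots<j_k$ the $d$-ascents of $\alpha$. $\tilde{A}_d=\{\alpha\in A_d:\mathrm{hat}_d(\alpha)=\alpha\}$. Fibonacci polynomials: $F_{d,n}(x)=1$ for integers $n<d$ and $F_{d,n}(x)=F_{d,n-1}(x)+xF_{d,n-d}(x)$ for $n\ge d$ (for $d=0$ this recurrence gives the formal power series $F_{0,n}(x)=(1-x)^{-(n+1)}$).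 Fibotorials: $F^{!}_{d,n}(x)=\prod_{i=0}^{n}F_{d,i}(x)$. *)

theory Defs
  imports "HOL-Computational_Algebra.Formal_Power_Series"
begin

text \<open>
  Words are lists of natural numbers, and positions are counted from 0, so the entry
  \<open>w ! i\<close> is the letter $a_{i+1}$ of the word and \<open>take i w\<close> is the prefix before it.
\<close>

definition asc_set :: "nat \<Rightarrow> nat list \<Rightarrow> nat set" where
  "asc_set d w = {i. i < length w \<and> (i = 0 \<or> int (w ! i) > int (w ! (i - 1)) - int d)}"

definition asc :: "nat \<Rightarrow> nat list \<Rightarrow> nat" where
  "asc d w = card (asc_set d w)"

definition ascent_seqs :: "nat \<Rightarrow> nat list set" where
  "ascent_seqs d =
     {w. (\<forall>a \<in> set w. 1 \<le> a) \<and> (\<forall>i < length w. w ! i \<le> 1 + asc d (take i w))}"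

definition modify :: "nat list \<Rightarrow> nat \<Rightarrow> nat list" where
  "modify w j = map (\<lambda>i. if i < j \<and> w ! i \<ge> w ! j then w ! i + 1 else w ! i) [0..<length w]"

text \<open>The ascent positions are those of the original word \<open>w\<close>, processed in increasing order.\<close>

definition hat :: "nat \<Rightarrow> nat list \<Rightarrow> nat list" where
  "hat d w = foldl modify w (sorted_list_of_set (asc_set d w))"

definition self_modified :: "nat \<Rightarrow> nat list set" where
  "self_modified d = {w \<in> ascent_seqs d. hat d w = w}"

definition max_letter :: "nat list \<Rightarrow> nat" where
  "max_letter w = (if w = [] then 0 else Max (set w))"

text \<open>
  The polynomials $F_{d,n}(x)$, as power series in $x$. For $d = 0$ the recurrence
  $F_{0,n} = F_{0,n-1} + x F_{0,n}$ defines $F_{0,n}$ only implicitly, so its solution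
  $(1-x)^{-(n+1)}$ is used; over the integers $(1-x)^{-1}$ is written as the series with all
  coefficients 1.
\<close>

function fib_poly :: "nat \<Rightarrow> int \<Rightarrow> int fps" where
  "fib_poly d n =
     (if n < int d then 1
      else if d = 0 then (Abs_fps (\<lambda>_. 1)) ^ nat (n + 1)
      else fib_poly d (n - 1) + fps_X * fib_poly d (n - int d))"
  by pat_completeness auto
termination
  by (relation "measure (\<lambda>(d, n). nat (n - int d + 1))") auto

declare fib_poly.simps [simp del]

lemma geometric_fps: "(1 - fps_X) * Abs_fps (\<lambda>_. 1 :: int) = 1"
proof (rule fps_ext)
  fix n
  show "fps_nth ((1 - fps_X) * Abs_fps (\<lambda>_. 1 :: int)) n = fps_nth 1 n"
    by (cases n) (simp_all add: left_diff_distrib)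
qed

lemma fib_poly_less: "n < int d \<Longrightarrow> fib_poly d n = 1"
  by (simp add: fib_poly.simps)

lemma fib_poly_rec:
  assumes "int d \<le> n"
  shows "fib_poly d n = fib_poly d (n - 1) + fps_X * fib_poly d (n - int d)"
proof (cases "d = 0")
  case True
  define g :: "int fps" where "g = Abs_fps (\<lambda>_. 1)"
  have g: "g = 1 + fps_X * g"
    using geometric_fps by (simp add: g_def algebra_simps)
  have n: "nat (n + 1) = Suc (nat n)" and "0 \<le> n"
    using assms by auto
  have prev: "fib_poly 0 (n - 1) = g ^ nat n"
  proof (cases "n = 0")
    case True
    then show ?thesis by (simp add: fib_poly.simps)
  next
    case False
    then show ?thesis using \<open>0 \<le> n\<close> by (subst fib_poly.simps) (simp add: g_def)
  qed
  have cur: "fib_poly 0 n = g ^ Suc (nat n)"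
    using \<open>0 \<le> n\<close> n by (subst fib_poly.simps) (simp add: g_def)
  have "g ^ Suc (nat n) = (1 + fps_X * g) * g ^ nat n"
    using g by simp
  also have "\<dots> = g ^ nat n + fps_X * g ^ Suc (nat n)"
    by (simp add: algebra_simps)
  finally show ?thesis
    using True prev cur by simp
next
  case False
  then show ?thesis using assms by (subst fib_poly.simps) simp
qed

definition fibotorial :: "nat \<Rightarrow> nat \<Rightarrow> int fps" where
  "fibotorial d n = (\<Prod>i = 0..n. fib_poly d (int i))"

text \<open>
  Bivariate series are elements of \<open>int fps fps\<close>, whose inner variable is always $x$.
  The outer variable is $y$ in \<open>fibotorial_series\<close> and $q$ in \<open>self_modified_series\<close>;
  the coefficient of $q^k x^n$ in the latter is the number of words with maximum $k$ and
  length $n$.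
\<close>

definition fibotorial_series :: "nat \<Rightarrow> int fps fps" where
  "fibotorial_series d = Abs_fps (\<lambda>n. fibotorial d n)"

definition self_modified_series :: "nat \<Rightarrow> int fps fps" where
  "self_modified_series d =
     Abs_fps (\<lambda>k. Abs_fps (\<lambda>n.
       of_nat (card {w \<in> self_modified d. max_letter w = k \<and> length w = n})))"

lemma finite_ascent_seqs_length: "finite {w \<in> ascent_seqs d. length w = n}"
proof (rule finite_subset)
  show "{w \<in> ascent_seqs d. length w = n} \<subseteq> {w. set w \<subseteq> {..n + 1} \<and> length w = n}"
  proof (intro subsetI CollectI conjI)
    fix w a
    assume "w \<in> {w \<in> ascent_seqs d. length w = n}" and a: "a \<in> set w"
    then have w: "w \<in> ascent_seqs d" and len: "length w = n"
      by simp_all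
    from a obtain i where i: "i < length w" "w ! i = a"
      by (auto simp: in_set_conv_nth)
    have "asc d (take i w) \<le> card {..<i}"
      unfolding asc_def using i(1) by (intro card_mono) (auto simp: asc_set_def)
    moreover have "w ! i \<le> 1 + asc d (take i w)"
      using w i(1) by (simp add: ascent_seqs_def)
    ultimately show "a \<in> {..n + 1}"
      using i len by simp
  qed simp
  show "finite {w. set w \<subseteq> {..n + 1} \<and> length w = n}"
    by (rule finite_lists_length_eq) simp
qed

definition q_var :: "int fps fps" where
  "q_var = fps_X"

definition x_var :: "int fps fps" where
  "x_var = fps_const fps_X"

end

theory Submission
  imports Defs
begin

text \<open>
  The map \<open>hat\<close> only increases letters, so it fixes a word exactly when every \<open>d\<close>-ascent is a strict
  left-to-right maximum. In an ascent sequence with this property the number of ascents equals the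
  maximum, so each ascent exceeds the previous maximum by exactly one: the words are those in which
  every new letter is either one more than the current maximum or smaller than its predecessor
  by at least \<open>d\<close>. Hence a word with maximum \<open>k\<close> splits into blocks headed by \<open>1, \<dots>, k\<close>, each of
  which descends by steps of size at least \<open>d\<close>, and the block headed by \<open>m\<close> contributes the
  factor $x F_{d,m-1}(x)$.
\<close>

section \<open>Fixed points of \<open>hat\<close>\<close>

lemma list_all2_le_modify: "list_all2 (\<le>) w (modify w j)"
  by (auto simp: modify_def list_all2_conv_all_nth)

lemma list_all2_le_foldl_modify: "list_all2 (\<le>) w (foldl modify w js)"
proof (induction js arbitrary: w)
  case Nil
  then show ?case by (simp add: list.rel_refl)
next
  case (Cons j js)
  have "list_all2 (\<le>) w (modify w j)" "list_all2 (\<le>) (modify w j) (foldl modify (modify w j) js)"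
    using list_all2_le_modify Cons.IH by blast+
  then show ?case
    using list_all2_trans[of "(\<le>)" "(\<le>)" "(\<le>)"] by (metis foldl_Cons order_trans)
qed

text \<open>Modification never lowers a letter, so later steps cannot undo a change: if the
  composition returns \<open>w\<close>, its first step already fixes \<open>w\<close>.\<close>

lemma foldl_modify_eq_iff: "foldl modify w js = w \<longleftrightarrow> (\<forall>j \<in> set js. modify w j = w)"
proof (induction js)
  case Nil
  then show ?case by simp
next
  case (Cons j js)
  have "modify w j = w" if "foldl modify (modify w j) js = w"
    using that list_all2_le_modify[of w j] list_all2_le_foldl_modify[of "modify w j" js]
    by (metis (no_types, lifting) list_all2_antisym order_antisym)
  then show ?case
    using Cons.IH by auto
qed

lemma modify_eq_iff:
  assumes "j < length w"
  shows "modify w j = w \<longleftrightarrow> (\<forall>i<j. w ! i < w ! j)"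
proof -
  have len: "length (modify w j) = length w"
    by (simp add: modify_def)
  have fixed: "modify w j ! i = w ! i \<longleftrightarrow> (i < j \<longrightarrow> w ! i < w ! j)" if "i < length w" for i
    using that by (auto simp: modify_def)
  have "modify w j = w \<longleftrightarrow> (\<forall>i<length w. modify w j ! i = w ! i)"
    by (simp only: list_eq_iff_nth_eq len simp_thms)
  also have "\<dots> \<longleftrightarrow> (\<forall>i<length w. i < j \<longrightarrow> w ! i < w ! j)"
    using fixed by blast
  also have "\<dots> \<longleftrightarrow> (\<forall>i<j. w ! i < w ! j)"
    using assms order_less_trans by blast
  finally show ?thesis .
qed

lemma finite_asc_set: "finite (asc_set d w)"
  by (simp add: asc_set_def)

lemma hat_eq_iff: "hat d w = w \<longleftrightarrow> (\<forall>j \<in> asc_set d w. \<forall>i<j. w ! i < w ! j)"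
proof -
  have "hat d w = w \<longleftrightarrow> (\<forall>j \<in> asc_set d w. modify w j = w)"
    by (simp add: hat_def foldl_modify_eq_iff finite_asc_set)
  then show ?thesis
    by (simp add: modify_eq_iff asc_set_def)
qed

section \<open>Self-modified words built letter by letter\<close>

definition final_letter :: "nat list \<Rightarrow> nat" where
  "final_letter w = (if w = [] then 0 else last w)"

lemma final_letter_snoc [simp]: "final_letter (w @ [a]) = a"
  by (simp add: final_letter_def)

lemma max_letter_Nil [simp]: "max_letter [] = 0"
  by (simp add: max_letter_def)

lemma max_letter_snoc [simp]: "max_letter (w @ [a]) = max (max_letter w) a"
  by (simp add: max_letter_def max.commute)

lemma final_letter_le_max_letter: "final_letter w \<le> max_letter w"
  by (simp add: final_letter_def max_letter_def)

lemma asc_set_snoc: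
  "asc_set d (w @ [a]) =
     (if w = [] \<or> final_letter w < a + d then insert (length w) (asc_set d w) else asc_set d w)"
  by (cases "w = []")
    (auto simp: asc_set_def nth_append final_letter_def last_conv_nth less_Suc_eq)

lemma asc_snoc:
  "asc d (w @ [a]) = (if w = [] \<or> final_letter w < a + d then Suc (asc d w) else asc d w)"
  using finite_asc_set[of d w]
  by (auto simp: asc_def asc_set_snoc) (simp add: asc_set_def)+

lemma ascent_seqs_snoc:
  "w @ [a] \<in> ascent_seqs d \<longleftrightarrow> w \<in> ascent_seqs d \<and> 1 \<le> a \<and> a \<le> 1 + asc d w"
  by (auto simp: ascent_seqs_def nth_append less_Suc_eq)

lemma hat_snoc:
  "hat d (w @ [a]) = w @ [a] \<longleftrightarrow>
     hat d w = w \<and> (w = [] \<or> final_letter w < a + d \<longrightarrow> (\<forall>b \<in> set w. b < a))"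
proof -
  have "(\<forall>j \<in> asc_set d w. \<forall>i<j. (w @ [a]) ! i < (w @ [a]) ! j) \<longleftrightarrow> hat d w = w"
    unfolding hat_eq_iff by (intro ball_cong refl) (auto simp: nth_append asc_set_def)
  moreover have "(\<forall>i<length w. (w @ [a]) ! i < (w @ [a]) ! length w) \<longleftrightarrow> (\<forall>b \<in> set w. b < a)"
    by (simp add: nth_append all_set_conv_all_nth)
  ultimately show ?thesis
    by (auto simp only: hat_eq_iff[of d "w @ [a]"] asc_set_snoc ball_simps split: if_splits)
qed

lemma self_modified_snoc_asc:
  "w @ [a] \<in> self_modified d \<longleftrightarrow>
     w \<in> self_modified d \<and> 1 \<le> a \<and> a \<le> 1 + asc d w \<and>
     (final_letter w < a + d \<longrightarrow> max_letter w < a)"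
proof (cases "w = []")
  \<comment> \<open>The default 0 of \<open>final_letter\<close> absorbs the disjunct
    \<open>w = []\<close>: with \<open>1 \<le> a\<close> the ascent condition
    \<open>0 < a + d\<close> holds.\<close>
  case True
  then show ?thesis
    by (auto simp: self_modified_def ascent_seqs_snoc[of "[]", simplified]
        hat_snoc[of d "[]", simplified])
next
  case False
  then show ?thesis
    by (auto simp: self_modified_def ascent_seqs_snoc hat_snoc max_letter_def)
qed

lemma Nil_in_self_modified: "[] \<in> self_modified d"
  by (simp add: self_modified_def ascent_seqs_def hat_eq_iff asc_set_def)

text \<open>By induction an appended ascent lies above the maximum and at most one above it, so both
  quantities grow by one. Any other letter is at most the final letter and changes neither.\<close>

lemma asc_eq_max_letter: "w \<in> self_modified d \<Longrightarrow> asc d w = max_letter w"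
proof (induction w rule: rev_induct)
  case Nil
  then show ?case by (simp add: asc_def asc_set_def)
next
  case (snoc a w)
  then show ?case
    using final_letter_le_max_letter[of w]
    by (auto simp: asc_snoc self_modified_snoc_asc final_letter_def)
qed

lemma self_modified_snoc:
  "w @ [a] \<in> self_modified d \<longleftrightarrow>
     w \<in> self_modified d \<and> (a = Suc (max_letter w) \<or> 1 \<le> a \<and> a + d \<le> final_letter w)"
  using final_letter_le_max_letter[of w]
  by (auto simp: self_modified_snoc_asc asc_eq_max_letter)

lemma self_modified_append: "u @ s \<in> self_modified d \<Longrightarrow> u \<in> self_modified d"
proof (induction s rule: rev_induct)
  case (snoc a s)
  then show ?case
    using self_modified_snoc[of "u @ s" a d] by simp
qed simp

section \<open>Extending a given prefix\<close>

text \<open>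
  \<open>continues d k m l s\<close>: appending \<open>s\<close> to a self-modified word with maximum \<open>m\<close> and final letter \<open>l\<close>
  yields a self-modified word with maximum \<open>k\<close>.
\<close>

primrec continues :: "nat \<Rightarrow> nat \<Rightarrow> nat \<Rightarrow> nat \<Rightarrow> nat list \<Rightarrow> bool" where
  "continues d k m l [] \<longleftrightarrow> m = k"
| "continues d k m l (a # s) \<longleftrightarrow>
     a = Suc m \<and> continues d k (Suc m) (Suc m) s \<or> a \<in> {1..l - d} \<and> continues d k m a s"

lemma continues_iff:
  assumes "u \<in> self_modified d"
  shows "continues d k (max_letter u) (final_letter u) s \<longleftrightarrow>
           u @ s \<in> self_modified d \<and> max_letter (u @ s) = k"
  using assms
proof (induction s arbitrary: u)
  case Nil
  then show ?case by simp
next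
  case (Cons a s)
  note final = final_letter_le_max_letter[of u]
  show ?case
  proof (cases "u @ [a] \<in> self_modified d")
    case True
    then have "continues d k (max (max_letter u) a) a s \<longleftrightarrow>
        u @ a # s \<in> self_modified d \<and> max_letter (u @ a # s) = k"
      using Cons.IH[OF True] by simp
    \<comment> \<open>Truncated subtraction is harmless: for \<open>1 \<le> a\<close>, the bounds
      \<open>a \<le> l - d\<close> and \<open>a + d \<le> l\<close> agree.\<close>
    moreover consider "a = Suc (max_letter u)" | "a \<in> {1..final_letter u - d}" "a \<le> max_letter u"
      using True final by (auto simp: self_modified_snoc)
    then have "continues d k (max_letter u) (final_letter u) (a # s) \<longleftrightarrow>
        continues d k (max (max_letter u) a) a s"
      using final by cases (auto simp: max_absorb1)
    ultimately show ?thesis by simp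
  next
    case False
    then have "u @ a # s \<notin> self_modified d"
      using self_modified_append[of "u @ [a]" s d] by auto
    moreover have "a \<noteq> Suc (max_letter u)" "a \<notin> {1..final_letter u - d}"
      using False Cons.prems by (auto simp: self_modified_snoc)
    ultimately show ?thesis by auto
  qed
qed

section \<open>Counting by length\<close>

definition continuations :: "nat \<Rightarrow> nat \<Rightarrow> nat \<Rightarrow> nat \<Rightarrow> nat \<Rightarrow> nat list set" where
  "continuations d k m l n = {s. continues d k m l s \<and> length s = n}"

lemma continuations_0: "continuations d k m l 0 = (if m = k then {[]} else {})"
  by (auto simp: continuations_def)

lemma continuations_Suc:
  "continuations d k m l (Suc n) =
     (#) (Suc m) ` continuations d k (Suc m) (Suc m) n \<union>
     (\<Union>a \<in> {1..l - d}. (#) a ` continuations d k m a n)"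
proof (rule set_eqI)
  fix s
  show "s \<in> continuations d k m l (Suc n) \<longleftrightarrow>
      s \<in> (#) (Suc m) ` continuations d k (Suc m) (Suc m) n \<union>
        (\<Union>a \<in> {1..l - d}. (#) a ` continuations d k m a n)"
    by (cases s) (auto simp: continuations_def image_iff)
qed

lemma finite_continuations: "finite (continuations d k m l n)"
  by (induction n arbitrary: m l) (auto simp: continuations_0 continuations_Suc)

lemma card_continuations_Suc:
  assumes "l \<le> m"
  shows "card (continuations d k m l (Suc n)) =
           card (continuations d k (Suc m) (Suc m) n) +
           (\<Sum>a = 1..l - d. card (continuations d k m a n))"
proof -
  have "card (\<Union>a \<in> {1..l - d}. (#) a ` continuations d k m a n) =
      (\<Sum>a = 1..l - d. card ((#) a ` continuations d k m a n))"
    by (rule card_UN_disjoint) (auto simp: finite_continuations)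
  \<comment> \<open>Since \<open>l \<le> m\<close>, a letter of \<open>{1..l - d}\<close> is never
    \<open>Suc m\<close>.\<close>
  moreover have "(#) (Suc m) ` continuations d k (Suc m) (Suc m) n \<inter>
      (\<Union>a \<in> {1..l - d}. (#) a ` continuations d k m a n) = {}"
    using assms by auto
  ultimately show ?thesis
    unfolding continuations_Suc
    by (subst card_Un_disjoint) (auto simp: finite_continuations card_image)
qed

lemma continuations_above: "k < m \<Longrightarrow> continuations d k m l n = {}"
  by (induction n arbitrary: m l) (auto simp: continuations_0 continuations_Suc)

text \<open>Unrolling the recurrence shows what the polynomial counts: after a letter
  \<open>l\<close>, a block either stops or goes on with some \<open>a\<close> in
  \<open>{1..l - d}\<close>. Integer indices cover \<open>l = 0\<close>, where the value is
  1.\<close>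

lemma fib_poly_eq_sum:
  "fib_poly d (int l - 1) = 1 + fps_X * (\<Sum>a = 1..l - d. fib_poly d (int a - 1))"
proof (induction l)
  case 0
  then show ?case by (simp add: fib_poly_less)
next
  case (Suc l)
  show ?case
  proof (cases "d \<le> l")
    case True
    then have "Suc l - d = Suc (l - d)" "int (Suc (l - d)) - 1 = int l - int d"
      by auto
    then show ?thesis
      using Suc.IH fib_poly_rec[of d "int l"] True by (simp add: algebra_simps)
  next
    case False
    then show ?thesis by (simp add: fib_poly_less)
  qed
qed

text \<open>The first factor counts the rest of the current block; each \<open>i\<close> in
  \<open>{m..<k}\<close> stands for the later block headed by \<open>Suc i\<close>. The induction
  splits on the first appended letter.\<close>

lemma card_continuations:
  assumes "l \<le> m" "m \<le> k"
  shows "int (card (continuations d k m l n)) =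
           fps_nth (fib_poly d (int l - 1) * (fps_X ^ (k - m) * (\<Prod>i = m..<k. fib_poly d (int i)))) n"
  using assms
proof (induction n arbitrary: m l)
  case 0
  have "fps_nth (fib_poly d (int l - 1)) 0 = 1"
    by (subst fib_poly_eq_sum) simp
  with 0 show ?case
    by (auto simp: continuations_0 fps_X_power_iff)
next
  case (Suc n)
  define P where "P m = fps_X ^ (k - m) * (\<Prod>i = m..<k. fib_poly d (int i))" for m
  have IH: "int (card (continuations d k m l n)) = fps_nth (fib_poly d (int l - 1) * P m) n"
    if "l \<le> m" "m \<le> k" for m l
    using Suc.IH that by (simp add: P_def)
  \<comment> \<open>In positive degree, \<open>P m\<close> counts the continuations that start with
    a new maximum. If \<open>m = k\<close> there are none, and \<open>P k = 1\<close>.\<close>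
  have "fps_nth (P m) (Suc n) = int (card (continuations d k (Suc m) (Suc m) n))"
  proof (cases "m = k")
    case True
    then show ?thesis by (simp add: P_def continuations_above)
  next
    case False
    with Suc.prems have "m < k" and "k - m = Suc (k - Suc m)" by simp_all
    then have "P m = fps_X * (fib_poly d (int m) * P (Suc m))"
      by (simp add: P_def prod.atLeast_Suc_lessThan mult_ac)
    then show ?thesis
      using \<open>m < k\<close> IH[of "Suc m" "Suc m"] by simp
  qed
  moreover have "fps_nth (\<Sum>a = 1..l - d. fib_poly d (int a - 1) * P m) n =
      (\<Sum>a = 1..l - d. int (card (continuations d k m a n)))"
    unfolding fps_sum_nth using Suc.prems by (intro sum.cong) (auto simp: IH)
  moreover have "fib_poly d (int l - 1) * P m =
      P m + fps_X * (\<Sum>a = 1..l - d. fib_poly d (int a - 1) * P m)"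
    by (subst fib_poly_eq_sum) (simp add: algebra_simps sum_distrib_left)
  ultimately show ?case
    using Suc.prems by (simp add: card_continuations_Suc P_def)
qed

lemma self_modified_series_nth:
  "fps_nth (self_modified_series d) k = fps_X ^ k * (\<Prod>i = 0..<k. fib_poly d (int i))"
proof (rule fps_ext)
  fix n
  have "{w \<in> self_modified d. max_letter w = k \<and> length w = n} = continuations d k 0 0 n"
    using continues_iff[OF Nil_in_self_modified, of d k]
    by (auto simp: continuations_def final_letter_def)
  \<comment> \<open>For the empty word \<open>m = l = 0\<close>, and the leading factor
    \<open>fib_poly d (-1)\<close> is 1.\<close>
  then show "fps_nth (fps_nth (self_modified_series d) k) n =
      fps_nth (fps_X ^ k * (\<Prod>i = 0..<k. fib_poly d (int i))) n"
    using card_continuations[of 0 0 k d n]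
    by (simp add: self_modified_series_def fib_poly_less)
qed

theorem theorem4p4:
  fixes d :: nat
  shows "self_modified_series d =
           1 + q_var * x_var * (fibotorial_series d oo (q_var * x_var))"
proof (rule fps_ext)
  fix k
  have qx: "q_var * x_var = fps_const fps_X * fps_X"
    by (simp add: q_var_def x_var_def mult.commute)
  \<comment> \<open>As qx is linear in the outer variable q, substituting it for y scales the n-th
    coefficient by x^n.\<close>
  have "fibotorial_series d oo (q_var * x_var) = Abs_fps (\<lambda>n. fps_X ^ n * fibotorial d n)"
    by (simp add: qx fps_compose_linear fibotorial_series_def)
  \<comment> \<open>The prefactor qx shifts the index: \<open>k = Suc n\<close> meets
    \<open>fibotorial d n\<close>, and \<open>k = 0\<close> leaves the summand 1.\<close>
  then show "fps_nth (self_modified_series d) k =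
      fps_nth (1 + q_var * x_var * (fibotorial_series d oo (q_var * x_var))) k"
    by (cases k)
      (simp_all add: self_modified_series_nth qx mult.assoc fibotorial_def atLeastLessThanSuc_atLeastAtMost)
qed

end
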